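(* For integers $k,n\ge 1$, let $c_{k,n,o}$ (respectively $c_{k,n,e}$) be the number of odd (respectively even) compositions of $n+k-1$ all of whose parts are no less than $k$, and let $b_{k,n}:=c_{k,n,o}-c_{k,n,e}$. Then \[ b_{k,n}=\sum_{0\le j\le (n-1)/k} (-1)^j\binom{n-1-j(k-1)}{j}, \] where the sum is over integers $j$.
   Context: A composition of a nonnegative integer $N$ is a finite sequence $\alpha=(\alpha_1,\ldots,\alpha_\ell)$ of positive integers with $\alpha_1+\cdots+\alpha_\ell=N$; the $\alpha_i$ are its parts and $\ell$ is its length. A composition is called even (respectively odd) if its length $\ell$ is even (respectively odd). *)

theory Defs
  imports Complex_Main
begin

definition compositions :: "nat \<Rightarrow> nat list set" where
  "compositions N = {\<alpha>. (\<forall>a\<in>set \<alpha>. 0 < a) \<and> sum_list \<alpha> = N}"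

definition c_odd :: "nat \<Rightarrow> nat \<Rightarrow> nat" where
  "c_odd k n = card {\<alpha> \<in> compositions (n + k - 1). odd (length \<alpha>) \<and> (\<forall>a\<in>set \<alpha>. k \<le> a)}"

definition c_even :: "nat \<Rightarrow> nat \<Rightarrow> nat" where
  "c_even k n = card {\<alpha> \<in> compositions (n + k - 1). even (length \<alpha>) \<and> (\<forall>a\<in>set \<alpha>. k \<le> a)}"

definition b :: "nat \<Rightarrow> nat \<Rightarrow> int" where
  "b k n = int (c_odd k n) - int (c_even k n)"

(* Finiteness ensures that card in c_odd and c_even is a genuine count. *)
lemma finite_compositions: "finite (compositions N)"
proof (rule finite_subset)
  have len: "length xs \<le> sum_list xs" if "\<forall>a\<in>set xs. 0 < a" for xs :: "nat list"
    using that by (induction xs) auto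
  show "compositions N \<subseteq> {xs. set xs \<subseteq> {..N} \<and> length xs \<le> N}"
    using len by (auto simp: compositions_def dest: member_le_sum_list)
  show "finite {xs. set xs \<subseteq> {..N} \<and> length xs \<le> N}"
    by (rule finite_lists_length_le) simp
qed

end

theory Submission
  imports Defs
begin

text \<open>
  Let \<open>s(N)\<close> be the sum of \<open>(-1)\<close> to the length over all compositions of \<open>N\<close> with parts at
  least \<open>k\<close>, so that \<open>b k n = - s(n + k - 1)\<close>. For \<open>N \<ge> 1\<close>, a composition of \<open>N + 1\<close> either
  starts with \<open>k\<close>, which can be removed, or starts with a larger part, which can be decreased
  by one; hence \<open>s(N + 1) = s(N) - s(N + 1 - k)\<close>. By Pascal's rule the alternating binomial sum
  satisfies the same recurrence, with the same initial values.
\<close>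

definition restricted_compositions :: "nat \<Rightarrow> nat \<Rightarrow> nat list set" where
  "restricted_compositions k N = {\<alpha> \<in> compositions N. \<forall>a\<in>set \<alpha>. k \<le> a}"

definition signed_count :: "nat \<Rightarrow> nat \<Rightarrow> int" where
  "signed_count k N = (\<Sum>\<alpha>\<in>restricted_compositions k N. (-1) ^ length \<alpha>)"

definition alternating_binomial_sum :: "nat \<Rightarrow> nat \<Rightarrow> int" where
  "alternating_binomial_sum k m =
    (\<Sum>j = 0..m div k. (-1) ^ j * int ((m - j * (k - 1)) choose j))"

lemma finite_restricted_compositions: "finite (restricted_compositions k N)"
  unfolding restricted_compositions_def using finite_compositions by simp

text \<open>Splitting by parity of the length, the odd compositions contribute -1 each; hence the
  minus sign.\<close>

lemma b_eq_signed_count: "b k n = - signed_count k (n + k - 1)"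
proof -
  let ?A = "restricted_compositions k (n + k - 1)"
  let ?E = "{\<alpha> \<in> ?A. even (length \<alpha>)}" and ?O = "{\<alpha> \<in> ?A. odd (length \<alpha>)}"
  have A: "?A = ?E \<union> ?O" by auto
  have "signed_count k (n + k - 1)
      = (\<Sum>\<alpha>\<in>?E. (-1) ^ length \<alpha>) + (\<Sum>\<alpha>\<in>?O. (-1) ^ length \<alpha>)"
    unfolding signed_count_def using finite_restricted_compositions[of k "n + k - 1"]
    by (subst A, subst sum.union_disjoint) auto
  also have "\<dots> = int (card ?E) - int (card ?O)"
    by simp
  also have "card ?E = c_even k n"
    unfolding c_even_def restricted_compositions_def by (rule arg_cong[where f = card]) auto
  also have "card ?O = c_odd k n"
    unfolding c_odd_def restricted_compositions_def by (rule arg_cong[where f = card]) auto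
  finally show ?thesis by (simp add: b_def)
qed

lemma restricted_compositions_Nil_iff [simp]:
  "[] \<in> restricted_compositions k N \<longleftrightarrow> N = 0"
  by (auto simp: restricted_compositions_def compositions_def)

lemma restricted_compositions_Cons_iff:
  assumes "k \<ge> 1"
  shows "a # \<alpha> \<in> restricted_compositions k N \<longleftrightarrow>
    k \<le> a \<and> a \<le> N \<and> \<alpha> \<in> restricted_compositions k (N - a)"
  using assms by (auto simp: restricted_compositions_def compositions_def)

lemma restricted_compositions_eq_empty:
  assumes "0 < N" "N < k"
  shows "restricted_compositions k N = {}"
proof -
  have "\<alpha> \<notin> restricted_compositions k N" for \<alpha>
    using assms by (cases \<alpha>) (auto simp: restricted_compositions_Cons_iff)
  then show ?thesis by blast
qed

lemma restricted_compositions_self: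
  assumes "k \<ge> 1"
  shows "restricted_compositions k k = {[k]}"
proof -
  have "\<alpha> \<in> restricted_compositions k k \<longleftrightarrow> \<alpha> = [k]" for \<alpha>
  proof (cases \<alpha>)
    case (Cons a \<beta>)
    then show ?thesis using assms
      by (cases \<beta>) (auto simp: restricted_compositions_Cons_iff)
  qed (use assms in auto)
  then show ?thesis by blast
qed

text \<open>The bound \<open>N \<ge> 1\<close> keeps \<open>[]\<close>, whose \<open>hd\<close> is
  unspecified, out of the first piece. The bound \<open>k \<le> Suc N\<close> prevents truncation of
  \<open>Suc N - k\<close> to 0, which would admit a spurious \<open>[k]\<close>.\<close>

lemma restricted_compositions_Suc:
  assumes "k \<ge> 1" "N \<ge> 1" "k \<le> Suc N"
  shows "restricted_compositions k (Suc N) =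
    (\<lambda>\<alpha>. Suc (hd \<alpha>) # tl \<alpha>) ` restricted_compositions k N \<union>
    (#) k ` restricted_compositions k (Suc N - k)" (is "_ = ?f ` ?A \<union> ?B")
proof (rule set_eqI)
  fix \<alpha>
  show "\<alpha> \<in> restricted_compositions k (Suc N) \<longleftrightarrow> \<alpha> \<in> ?f ` ?A \<union> ?B"
  proof
    assume *: "\<alpha> \<in> restricted_compositions k (Suc N)"
    then obtain a \<beta> where \<alpha>: "\<alpha> = a # \<beta>" by (cases \<alpha>) auto
    show "\<alpha> \<in> ?f ` ?A \<union> ?B"
    proof (cases "a = k")
      case True
      then show ?thesis using * \<alpha> assms by (simp add: restricted_compositions_Cons_iff)
    next
      case False
      then obtain c where c: "a = Suc c" "k \<le> c"
        using * \<alpha> assms by (cases a) (auto simp: restricted_compositions_Cons_iff)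
      then have "c # \<beta> \<in> ?A" using * \<alpha> assms by (simp add: restricted_compositions_Cons_iff)
      moreover have "\<alpha> = ?f (c # \<beta>)" using \<alpha> c by simp
      ultimately show ?thesis by blast
    qed
  next
    assume "\<alpha> \<in> ?f ` ?A \<union> ?B"
    then show "\<alpha> \<in> restricted_compositions k (Suc N)"
    proof
      assume "\<alpha> \<in> ?f ` ?A"
      then obtain \<beta> where \<beta>: "\<beta> \<in> ?A" "\<alpha> = ?f \<beta>" by blast
      then show ?thesis using assms
        by (cases \<beta>) (auto simp: restricted_compositions_Cons_iff)
    qed (use assms in \<open>auto simp: restricted_compositions_Cons_iff\<close>)
  qed
qed

lemma signed_count_Suc:
  assumes "k \<ge> 1" "N \<ge> 1" "k \<le> Suc N"
  shows "signed_count k (Suc N) = signed_count k N - signed_count k (Suc N - k)"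
proof -
  let ?f = "\<lambda>\<alpha>. Suc (hd \<alpha>) # tl \<alpha> :: nat list"
  let ?A = "restricted_compositions k N" and ?B = "restricted_compositions k (Suc N - k)"
  have ne: "\<alpha> \<noteq> []" if "\<alpha> \<in> ?A" for \<alpha> using that assms by auto
  have hd: "k \<le> hd \<alpha>" if "\<alpha> \<in> ?A" for \<alpha>
    using that ne[OF that] assms by (cases \<alpha>) (auto simp: restricted_compositions_Cons_iff)
  \<comment> \<open>Raised heads exceed \<open>k\<close>, while the lists of the second piece start
    with \<open>k\<close> itself.\<close>
  have disj: "?f ` ?A \<inter> (#) k ` ?B = {}" using hd by fastforce
  have inj: "inj_on ?f ?A"
    \<comment> \<open>A nonempty list is determined by its head and tail, and \<open>?f\<close>
      loses neither.\<close>
    using ne by (auto intro!: inj_onI simp: list.expand)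
  have "signed_count k (Suc N)
      = (\<Sum>\<alpha>\<in>?f ` ?A. (-1) ^ length \<alpha>) + (\<Sum>\<alpha>\<in>(#) k ` ?B. (-1) ^ length \<alpha>)"
    unfolding signed_count_def restricted_compositions_Suc[OF assms]
    using disj by (intro sum.union_disjoint) (auto simp: finite_restricted_compositions)
  also have "(\<Sum>\<alpha>\<in>?f ` ?A. (-1) ^ length \<alpha>) = signed_count k N"
    unfolding signed_count_def sum.reindex[OF inj]
  proof (rule sum.cong)
    fix \<alpha> assume "\<alpha> \<in> ?A"
    then show "((\<lambda>\<alpha>. (-1) ^ length \<alpha>) \<circ> ?f) \<alpha> = ((-1) ^ length \<alpha> :: int)"
      using assms by (cases \<alpha>) auto
  qed simp
  also have "(\<Sum>\<alpha>\<in>(#) k ` ?B. (-1) ^ length \<alpha>) = - signed_count k (Suc N - k)"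
    by (simp add: sum.reindex signed_count_def sum_negf)
  finally show ?thesis by simp
qed

lemma alternating_binomial_sum_less:
  assumes "m < k"
  shows "alternating_binomial_sum k m = 1"
  using assms by (simp add: alternating_binomial_sum_def)

text \<open>Where \<open>m - j * (k - 1)\<close> truncates to \<open>0\<close>, the binomial still vanishes, because \<open>j > 0\<close> there.\<close>

lemma alternating_binomial_sum_extend:
  assumes "k \<ge> 1" "m div k \<le> M"
  shows "alternating_binomial_sum k m =
    (\<Sum>j = 0..M. (-1) ^ j * int ((m - j * (k - 1)) choose j))"
  unfolding alternating_binomial_sum_def
proof (rule sum.mono_neutral_left)
  show "\<forall>j\<in>{0..M} - {0..m div k}. (-1) ^ j * int ((m - j * (k - 1)) choose j) = 0"
  proof
    fix j assume "j \<in> {0..M} - {0..m div k}"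
    then have "m div k < j" by auto
    then have "m < j * k" using assms by (simp add: div_less_iff_less_mult)
    moreover have "j * k = j * (k - 1) + j" using assms by (cases k) auto
    moreover have "0 < j" using \<open>m div k < j\<close> by simp
    ultimately have "m - j * (k - 1) < j" by linarith
    then show "(-1) ^ j * int ((m - j * (k - 1)) choose j) = 0" by simp
  qed
qed (use assms in auto)

text \<open>Pascal's rule applies to the term of index \<open>j + 1\<close>. Its second summand is
  the term of index \<open>j\<close> for \<open>Suc m - k\<close>, since
  \<open>m - (j + 1) * (k - 1) = (Suc m - k) - j * (k - 1)\<close>; the index shift flips its
  sign.\<close>

lemma alternating_binomial_sum_Suc:
  assumes "k \<ge> 1" "k \<le> Suc m"
  shows "alternating_binomial_sum k (Suc m) =
    alternating_binomial_sum k m - alternating_binomial_sum k (Suc m - k)"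
proof -
  \<comment> \<open>\<open>M\<close> is the last index of the sum for \<open>Suc m - k\<close>, and
    \<open>Suc M\<close> that of the sum for \<open>Suc m\<close>.\<close>
  define M where "M = (Suc m - k) div k"
  have M: "Suc m div k = Suc M"
    unfolding M_def using assms by (simp add: le_div_geq)
  let ?t = "\<lambda>m j. (-1) ^ j * int ((m - j * (k - 1)) choose j)"
  have step: "?t (Suc m) (Suc j) = ?t m (Suc j) - ?t (Suc m - k) j" if "j \<le> M" for j
  proof -
    have "Suc j \<le> Suc m div k" using that M by simp
    then have "Suc j * k \<le> Suc m"
      using assms by (simp add: less_eq_div_iff_mult_less_eq)
    moreover have "Suc j * k = Suc j * (k - 1) + Suc j" using assms by (cases k) auto
    \<comment> \<open>Without truncation, the upper entry for \<open>Suc m\<close> is the successor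
      of the one for \<open>m\<close>, as Pascal's rule requires.\<close>
    ultimately have le: "Suc j * (k - 1) \<le> m" by linarith
    have "Suc m - k - j * (k - 1) = m - Suc j * (k - 1)" using assms by (cases k) auto
    then show ?thesis using le by (simp add: Suc_diff_le algebra_simps del: mult_Suc)
  qed
  have "alternating_binomial_sum k (Suc m) = ?t (Suc m) 0 + (\<Sum>j = 0..M. ?t (Suc m) (Suc j))"
    unfolding alternating_binomial_sum_def M
    by (simp only: sum.atLeast0_atMost_Suc_shift o_def)
  also have "(\<Sum>j = 0..M. ?t (Suc m) (Suc j)) =
      (\<Sum>j = 0..M. ?t m (Suc j)) - (\<Sum>j = 0..M. ?t (Suc m - k) j)"
    unfolding sum_subtractf[symmetric] by (intro sum.cong) (use step in auto)
  also have "(\<Sum>j = 0..M. ?t (Suc m - k) j) = alternating_binomial_sum k (Suc m - k)"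
    by (simp add: alternating_binomial_sum_def M_def)
  \<comment> \<open>The term of index 0 is 1 for \<open>Suc m\<close> and \<open>m\<close> alike, so
    it completes the sum for \<open>m\<close>.\<close>
  also have "?t (Suc m) 0 + ((\<Sum>j = 0..M. ?t m (Suc j)) - alternating_binomial_sum k (Suc m - k))
      = (\<Sum>j = 0..Suc M. ?t m j) - alternating_binomial_sum k (Suc m - k)"
    unfolding sum.atLeast0_atMost_Suc_shift o_def by simp
  \<comment> \<open>The sum for \<open>m\<close> may stop at \<open>M\<close> already; the extra
    term is then 0.\<close>
  also have "(\<Sum>j = 0..Suc M. ?t m j) = alternating_binomial_sum k m"
    using assms M by (intro alternating_binomial_sum_extend[symmetric])
      (auto simp flip: M intro: div_le_mono)
  finally show ?thesis .
qed

text \<open>The shift by \<open>k\<close> aligns the initial values: \<open>[k]\<close> alone gives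
  -1 at \<open>m = 0\<close>. Strong induction is used because the recurrence looks back
  \<open>k\<close> steps.\<close>

lemma signed_count_eq_alternating_binomial_sum:
  assumes "k \<ge> 1"
  shows "signed_count k (m + k) = - alternating_binomial_sum k m"
proof (induction m rule: less_induct)
  case (less m)
  show ?case
  proof (cases m)
    case 0
    then show ?thesis using assms
      by (simp add: signed_count_def restricted_compositions_self alternating_binomial_sum_less)
  next
    case (Suc l)
    have rec: "signed_count k (m + k) = signed_count k (l + k) - signed_count k m"
      using signed_count_Suc[of k "l + k"] assms Suc by simp
    have IH: "signed_count k (l + k) = - alternating_binomial_sum k l"
      using less Suc by simp
    show ?thesis
    \<comment> \<open>For \<open>0 < m < k\<close> the subtracted count is empty, and both binomial
      sums equal 1. Otherwise \<open>m = (m - k) + k\<close>, so the induction hypothesis also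
      covers \<open>signed_count k m\<close>.\<close>
    proof (cases "m < k")
      case True
      then show ?thesis using rec IH Suc
        by (simp add: signed_count_def restricted_compositions_eq_empty
            alternating_binomial_sum_less)
    next
      case False
      then have "signed_count k m = - alternating_binomial_sum k (m - k)"
        using less[of "m - k"] assms by simp
      then show ?thesis using rec IH Suc False alternating_binomial_sum_Suc[of k l] assms
        by simp
    qed
  qed
qed

theorem theorem2p3:
  fixes k n :: nat
  assumes "k \<ge> 1" and "n \<ge> 1"
  shows "b k n = (\<Sum>j = 0..(n - 1) div k. (-1) ^ j * int ((n - 1 - j * (k - 1)) choose j))"
  \<comment> \<open>Since \<open>n \<ge> 1\<close>, \<open>n + k - 1\<close> is
    \<open>(n - 1) + k\<close>.\<close>
  using signed_count_eq_alternating_binomial_sum[OF assms(1), of "n - 1"] assms(2)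
  by (simp add: b_eq_signed_count alternating_binomial_sum_def)

end
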